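(* Let $X$ be a Banach space that is not super-reflexive. Then the infinite dyadic tree equipped with the hyperbolic distance, $(T,\rho)$, embeds into $X$; that is, there exists an injective map $f:T\to X$ of finite distortion.
   Context: Tree: $\Omega_0=\{\varnothing\}$ (the root), $\Omega_n=\{-1,1\}^n$ for $n\ge 1$, $T_n=\bigcup_{i=0}^n\Omega_i$, and $T=\bigcup_{n=0}^\infty T_n$ is the infinite dyadic tree. For $\varepsilon\in T$, $|\varepsilon|$ denotes its length ($|\varepsilon|=n$ if $\varepsilon\in\Omega_n$); $\varepsilon\le\varepsilon'$ means that $\varepsilon'$ is an extension of $\varepsilon$ (i.e. $\varepsilon$ is an initial segment of $\varepsilon'$). The hyperbolic distance on $T$ is $\rho(\varepsilon,\varepsilon')=|\varepsilon|+|\varepsilon'|-2|\delta|$, where $\delta$ is the greatest common ancestor of $\varepsilon$ and $\varepsilon'$ (their longest common initial segment). Embedding: for metric spaces $(M,d)$, $(N,\delta)$ and an injective map $f:M\to N$, the distortion of $f$ is $$\mathrm{dist}(f)=\sup_{x\ne y\in M}\frac{\delta(f(x),f(y))}{d(x,y)}\cdot\sup_{x\ne y\in M}\frac{d(x,y)}{\delta(f(x),f(y))}.$$ If $\mathrm{dist}(f)<\infty$, $f$ is called a (metric) embedding of $M$ into $N$, and $M$ is said to embed into $N$. A Banach space carries the metric induced by its norm. *)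

theory Defs
  imports "HOL-Analysis.Analysis" "HOL-Library.Sublist"
begin

section \<open>The infinite dyadic tree with the hyperbolic distance\<close>

text \<open>A vertex is the finite list of its signs; the root is the empty list.\<close>

definition dyadic_level :: "nat \<Rightarrow> int list set" where
  "dyadic_level n = {e. length e = n \<and> set e \<subseteq> {-1, 1}}"

definition dyadic_tree_upto :: "nat \<Rightarrow> int list set" where
  "dyadic_tree_upto n = (\<Union>i\<le>n. dyadic_level i)"

definition dyadic_tree :: "int list set" where
  "dyadic_tree = (\<Union>n. dyadic_tree_upto n)"

definition hyperbolic_dist :: "int list \<Rightarrow> int list \<Rightarrow> real" where
  "hyperbolic_dist e e' =
     real (length e) + real (length e') - 2 * real (length (longest_common_prefix e e'))"

lemma mem_dyadic_tree_iff: "e \<in> dyadic_tree \<longleftrightarrow> set e \<subseteq> {-1, 1}"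
  by (auto simp: dyadic_tree_def dyadic_tree_upto_def dyadic_level_def)

lemma Metric_space_dyadic_tree: "Metric_space dyadic_tree hyperbolic_dist"
proof
  show "0 \<le> hyperbolic_dist x y" for x y
    using prefix_length_le[OF longest_common_prefix_prefix1[of x y]]
      prefix_length_le[OF longest_common_prefix_prefix2[of x y]]
    by (simp add: hyperbolic_dist_def)
  have comm: "longest_common_prefix x y = longest_common_prefix y x" for x y :: "int list"
    by (intro prefix_order.antisym longest_common_prefix_max_prefix
        longest_common_prefix_prefix1 longest_common_prefix_prefix2)
  show "hyperbolic_dist x y = hyperbolic_dist y x" for x y
    by (simp add: hyperbolic_dist_def comm[of x y])
  show "hyperbolic_dist x y = 0 \<longleftrightarrow> x = y" for x y
  proof
    have pre: "prefix (longest_common_prefix x y) x" "prefix (longest_common_prefix x y) y"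
      by (rule longest_common_prefix_prefix1 longest_common_prefix_prefix2)+
    assume "hyperbolic_dist x y = 0"
    then have "length (longest_common_prefix x y) = length x"
      "length (longest_common_prefix x y) = length y"
      using pre[THEN prefix_length_le] by (auto simp: hyperbolic_dist_def)
    then show "x = y"
      using pre by (metis append_eq_conv_conj prefix_def take_all_iff order_refl)
  next
    have "longest_common_prefix y y = y"
      by (intro prefix_order.antisym longest_common_prefix_max_prefix
        longest_common_prefix_prefix1) auto
    then show "hyperbolic_dist x y = 0" if "x = y"
      using that by (simp add: hyperbolic_dist_def)
  qed
  show "hyperbolic_dist x z \<le> hyperbolic_dist x y + hyperbolic_dist y z" for x y z
  proof -
    let ?a = "longest_common_prefix x y" and ?b = "longest_common_prefix y z"
    let ?c = "longest_common_prefix x z"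
    have pre: "prefix ?a x" "prefix ?a y" "prefix ?b y" "prefix ?b z"
      by (rule longest_common_prefix_prefix1 longest_common_prefix_prefix2)+
    have "prefix ?a ?b \<or> prefix ?b ?a"
      using pre(2,3) prefix_same_cases by blast
    then have "prefix ?a ?c \<or> prefix ?b ?c"
      using pre by (meson longest_common_prefix_max_prefix prefix_order.trans)
    then have "length ?a \<le> length ?c \<or> length ?b \<le> length ?c"
      using prefix_length_le by blast
    moreover have "length ?a \<le> length y" "length ?b \<le> length y"
      using pre prefix_length_le by blast+
    ultimately show ?thesis
      by (auto simp: hyperbolic_dist_def)
  qed
qed


section \<open>Metric embeddings\<close>

text \<open>
  The suprema are taken in the extended nonnegative reals, so that an unbounded ratio gives
  the value \<open>\<infinity>\<close>.  The quotients are quotients of reals; for injective \<open>f\<close> no denominator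
  vanishes.
\<close>

definition distortion ::
  "'m set \<Rightarrow> ('m \<Rightarrow> 'm \<Rightarrow> real) \<Rightarrow> ('n \<Rightarrow> 'n \<Rightarrow> real) \<Rightarrow> ('m \<Rightarrow> 'n) \<Rightarrow> ennreal" where
  "distortion M d \<delta> f =
     (SUP (x, y) \<in> {(x, y). x \<in> M \<and> y \<in> M \<and> x \<noteq> y}. ennreal (\<delta> (f x) (f y) / d x y)) *
     (SUP (x, y) \<in> {(x, y). x \<in> M \<and> y \<in> M \<and> x \<noteq> y}. ennreal (d x y / \<delta> (f x) (f y)))"

definition metric_embedding ::
  "'m set \<Rightarrow> ('m \<Rightarrow> 'm \<Rightarrow> real) \<Rightarrow> 'n set \<Rightarrow> ('n \<Rightarrow> 'n \<Rightarrow> real) \<Rightarrow> ('m \<Rightarrow> 'n) \<Rightarrow> bool" where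
  "metric_embedding M d N \<delta> f \<longleftrightarrow>
     f \<in> M \<rightarrow> N \<and> inj_on f M \<and> distortion M d \<delta> f < \<infinity>"


section \<open>Reflexivity and finite representability\<close>

definition canonical_bidual :: "'y::real_normed_vector \<Rightarrow> (('y \<Rightarrow>\<^sub>L real) \<Rightarrow>\<^sub>L real)" where
  "canonical_bidual y = Blinfun (\<lambda>\<phi>. blinfun_apply \<phi> y)"

lemma canonical_bidual_apply [simp]:
  "blinfun_apply (canonical_bidual y) \<phi> = blinfun_apply \<phi> y"
  by (simp add: canonical_bidual_def bounded_linear_Blinfun_apply
      blinfun.bounded_linear_left)

definition reflexive_space :: "'y::banach itself \<Rightarrow> bool" where
  "reflexive_space (_ :: 'y itself) \<longleftrightarrow>
     surj (canonical_bidual :: 'y \<Rightarrow> ('y \<Rightarrow>\<^sub>L real) \<Rightarrow>\<^sub>L real)"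

text \<open>
  \<open>Y\<close> is finitely representable in \<open>X\<close> if for every finite-dimensional subspace \<open>F\<close> of \<open>Y\<close>
  and every \<open>\<lambda> > 1\<close> there is a linear map \<open>F \<rightarrow> X\<close> with
  \<open>\<lambda>\<^sup>-\<^sup>1 \<parallel>y\<parallel> \<le> \<parallel>T y\<parallel> \<le> \<lambda> \<parallel>y\<parallel>\<close> on \<open>F\<close>.  The finite-dimensional subspaces are the spans of
  finite sets, and a linear map on \<open>F\<close> is represented by a linear extension of it to the type
  of \<open>Y\<close>; nothing is required of \<open>T\<close> outside \<open>F\<close>, not even continuity.
\<close>

definition finitely_representable ::
  "'y::real_normed_vector itself \<Rightarrow> 'x::real_normed_vector itself \<Rightarrow> bool" where
  "finitely_representable (_ :: 'y itself) (_ :: 'x itself) \<longleftrightarrow>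
     (\<forall>B :: 'y set. \<forall>l > 1. finite B \<longrightarrow>
        (\<exists>T :: 'y \<Rightarrow> 'x. linear T \<and>
           (\<forall>y \<in> span B. inverse l * norm y \<le> norm (T y) \<and> norm (T y) \<le> l * norm y)))"

text \<open>
  \<open>X\<close> is super-reflexive if every Banach space \<open>Y\<close> finitely representable in \<open>X\<close> is
  reflexive.  HOL cannot quantify over the types of class \<open>banach\<close> inside a formula, so the
  space \<open>Y\<close> is a second type argument.  The predicate below says that \<open>Y\<close> witnesses that \<open>X\<close> is
  not super-reflexive.  In a theorem having it as an assumption, with \<open>'y\<close> occurring nowhere
  else, the implicit universal quantification over \<open>'y\<close> amounts to the existential assumption
  that some such \<open>Y\<close> exists, i.e. that \<open>X\<close> is not super-reflexive.
\<close>

definition not_super_reflexive_witness :: "'x::banach itself \<Rightarrow> 'y::banach itself \<Rightarrow> bool" where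
  "not_super_reflexive_witness (_ :: 'x itself) (_ :: 'y itself) \<longleftrightarrow>
     finitely_representable TYPE('y) TYPE('x) \<and> \<not> reflexive_space TYPE('y)"

end

theory Submission
  imports Defs
begin

text \<open>
  A non-reflexive space contains, for one constant \<open>C\<close> and all \<open>N\<close>, vectors \<open>x\<^sub>0, \<dots>, x\<^sub>N\<^sub>-\<^sub>1\<close> and
  functionals \<open>\<phi>\<^sub>0, \<dots>, \<phi>\<^sub>N\<^sub>-\<^sub>1\<close> of norm at most \<open>C\<close> with \<open>\<phi>\<^sub>k x\<^sub>i = 1\<close> for \<open>k \<le> i\<close> and \<open>\<phi>\<^sub>k x\<^sub>i = 0\<close>
  otherwise (James), and finite representability carries them to \<open>X\<close>. If the vertices of a finite
  tree are numbered such that everything below a left child comes before everything below its right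
  sibling, then the sum of the \<open>x\<^sub>i\<close> along the path to a vertex embeds the tree: one \<open>\<phi>\<^sub>k\<close> separates the
  two branches below the greatest common ancestor (Bourgain).

  For the infinite tree, the levels \<open>2\<^sup>k, \<dots>, 2\<^sup>k\<^sup>+\<^sup>1 - 1\<close> use a system of their own, chosen to be
  almost annihilated by functionals norming the finitely many differences that can occur at lower
  levels. So a difference of two path sums almost dominates its truncations, and hence its parts in
  the last two blocks, which contain at least half of the longer path below the common ancestor.
\<close>

section \<open>The Hahn-Banach theorem\<close>

text \<open>Homogeneity is required only as an inequality for \<open>r > 0\<close>, which is easy to
  check for infima; applying it to the inverse of \<open>r\<close> gives equality.\<close>

definition sublinear :: "('a::real_vector \<Rightarrow> real) \<Rightarrow> bool" where
  "sublinear q \<longleftrightarrow> q 0 = 0 \<and> (\<forall>x y. q (x + y) \<le> q x + q y) \<and> (\<forall>r>0. \<forall>x. q (r *\<^sub>R x) \<le> r * q x)"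

lemma sublinear_add: "sublinear q \<Longrightarrow> q (x + y) \<le> q x + q y"
  by (simp add: sublinear_def)

lemma sublinear_scale:
  assumes "sublinear q" "0 \<le> r"
  shows "q (r *\<^sub>R x) = r * q x"
proof (cases "r = 0")
  case False
  then have r: "r > 0" using assms by simp
  have "q (inverse r *\<^sub>R (r *\<^sub>R x)) \<le> inverse r * q (r *\<^sub>R x)"
    using assms(1) r by (metis positive_imp_inverse_positive sublinear_def)
  then have "r * q x \<le> q (r *\<^sub>R x)"
    using r by (simp add: field_simps)
  moreover have "q (r *\<^sub>R x) \<le> r * q x"
    using assms(1) r by (simp add: sublinear_def)
  ultimately show ?thesis by simp
qed (use assms in \<open>auto simp: sublinear_def\<close>)

lemma sublinear_minus_ge:
  assumes "sublinear q" shows "- q (- x) \<le> q x"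
  using sublinear_add[OF assms, of x "-x"] assms by (simp add: sublinear_def)

text \<open>The infimum over \<open>t \<ge> 0\<close> of
  \<open>q (x + t *\<^sub>R y) - t * q y\<close> is again sublinear; \<open>t = 0\<close> and
  \<open>t = 1\<close> give the two bounds. For a minimal \<open>q\<close> it equals
  \<open>q\<close>, and the last bound becomes superadditivity.\<close>

lemma sublinear_descent:
  fixes q :: "'a::real_vector \<Rightarrow> real"
  assumes "sublinear q"
  obtains q' where "sublinear q'" "q' \<le> q" "\<And>x. q' x \<le> q (x + y) - q y"
proof
  define F where "F x t = q (x + t *\<^sub>R y) - t * q y" for x t
  define q' where "q' x = (INF t\<in>{0..}. F x t)" for x
  \<comment> \<open>This bound does not depend on \<open>t\<close>, so the infimum is
    finite.\<close>
  have lb: "- q (- x) \<le> F x t" if "t \<ge> 0" for x t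
    using sublinear_add[OF assms, of "x + t *\<^sub>R y" "- x"] sublinear_scale[OF assms that, of y]
    by (simp add: F_def)
  have bdd: "bdd_below (F x ` {0..})" for x
    using lb by (intro bdd_belowI[of _ "- q (- x)"]) auto
  have le: "q' x \<le> F x t" if "t \<ge> 0" for x t
    unfolding q'_def using that by (intro cINF_lower bdd) auto
  show "sublinear q'"
    unfolding sublinear_def
  proof (intro conjI allI impI)
    have "F 0 t = 0" if "t \<ge> 0" for t
      using sublinear_scale[OF assms that, of y] by (simp add: F_def)
    then have "F 0 ` {0..} = {0}" by force
    then show "q' 0 = 0" by (simp add: q'_def)
    show "q' (u + v) \<le> q' u + q' v" for u v
    proof -
      have *: "q' (u + v) \<le> F u s + F v t" if "s \<ge> 0" "t \<ge> 0" for s t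
      proof -
        have "q' (u + v) \<le> F (u + v) (s + t)" using that by (intro le) auto
        also have "\<dots> \<le> F u s + F v t"
          using sublinear_add[OF assms, of "u + s *\<^sub>R y" "v + t *\<^sub>R y"]
          by (simp add: F_def algebra_simps)
        finally show ?thesis .
      qed
      have "q' (u + v) - F u s \<le> q' v" if "s \<ge> 0" for s
        unfolding q'_def[of v] using * that by (intro cINF_greatest) (auto simp: algebra_simps)
      then have "q' (u + v) - q' v \<le> q' u"
        unfolding q'_def[of u] by (intro cINF_greatest) (auto simp: algebra_simps)
      then show ?thesis by simp
    qed
    show "q' (r *\<^sub>R x) \<le> r * q' x" if "r > 0" for r x
    proof -
      have "q' (r *\<^sub>R x) / r \<le> F x t" if "t \<ge> 0" for t
      proof -
        have "q' (r *\<^sub>R x) \<le> F (r *\<^sub>R x) (r * t)" using \<open>r > 0\<close> that by (intro le) auto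
        also have "\<dots> = r * F x t"
          using sublinear_scale[OF assms, of r "x + t *\<^sub>R y"] \<open>r > 0\<close>
          by (simp add: F_def algebra_simps)
        finally show ?thesis using \<open>r > 0\<close> by (simp add: field_simps)
      qed
      then have "q' (r *\<^sub>R x) / r \<le> q' x"
        unfolding q'_def[of x] by (intro cINF_greatest) auto
      then show ?thesis using \<open>r > 0\<close> by (simp add: field_simps)
    qed
  qed
  show "q' \<le> q"
    using le[of 0] by (auto simp: le_fun_def F_def)
  show "q' x \<le> q (x + y) - q y" for x
    using le[of 1 x] by (simp add: F_def)
qed

text \<open>A minimal sublinear functional is linear, by the descent above.\<close>

lemma exists_linear_below_sublinear:
  fixes p :: "'a::real_vector \<Rightarrow> real"
  assumes p: "sublinear p"
  obtains g where "linear g" "g \<le> p"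
proof -
  define A where "A = {q. sublinear q \<and> q \<le> p}"
  \<comment> \<open>The order is reversed, so that Zorn's lemma yields a minimal functional.\<close>
  have po: "partial_order_on A (relation_of (\<ge>) A)"
    by (auto simp: partial_order_on_def preorder_on_def refl_on_def trans_def antisym_def relation_of_def)
  have "\<exists>m\<in>A. \<forall>a\<in>A. m \<ge> a \<longrightarrow> a = m"
  proof (rule predicate_Zorn[OF po])
    fix Ch assume "Ch \<in> Chains (relation_of (\<ge>) A)"
    then have ChA: "Ch \<subseteq> A" and chain: "\<And>a b. a \<in> Ch \<Longrightarrow> b \<in> Ch \<Longrightarrow> a \<le> b \<or> b \<le> a"
      by (auto simp: Chains_def relation_of_def)
    show "\<exists>u\<in>A. \<forall>a\<in>Ch. u \<le> a"
    proof (cases "Ch = {}")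
      case True
      then show ?thesis using p by (auto simp: A_def)
    next
      case False
      define u where "u x = (INF q\<in>Ch. q x)" for x
      have sub: "sublinear q" "q \<le> p" if "q \<in> Ch" for q
        using that ChA by (auto simp: A_def)
      have "- p (- x) \<le> q x" if "q \<in> Ch" for q x
        using sublinear_minus_ge[OF sub(1)[OF that], of x] sub(2)[OF that] 
        by (smt (verit) le_fun_def)
      then have "bdd_below ((\<lambda>q. q x) ` Ch)" for x
        by (intro bdd_belowI[of _ "- p (- x)"]) auto
      then have le: "u x \<le> q x" if "q \<in> Ch" for q x
        unfolding u_def using that by (intro cINF_lower) auto
      have "sublinear u"
        unfolding sublinear_def
      proof (intro conjI allI impI)
        have "q 0 = 0" if "q \<in> Ch" for q using sub(1)[OF that] by (simp add: sublinear_def)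
        then have "(\<lambda>q. q 0) ` Ch = {0}" using False by force
        then show "u 0 = 0" by (simp add: u_def)
        show "u (x + y) \<le> u x + u y" for x y
        proof -
          have *: "u (x + y) \<le> q x + q' y" if qs: "q \<in> Ch" "q' \<in> Ch" for q q'
          proof -
            \<comment> \<open>The smaller of two chain members serves both summands at once.\<close>
            obtain r where "r \<in> Ch" "r \<le> q" "r \<le> q'" using chain[OF qs] qs by blast
            then show ?thesis
              using le[of r "x + y"] sublinear_add[OF sub(1), of r x y]
              by (smt (verit) le_fun_def)
          qed
          have "u (x + y) - q x \<le> u y" if "q \<in> Ch" for q
            unfolding u_def[of y] using *[OF that] False
            by (intro cINF_greatest) (auto simp: diff_le_eq add.commute)
          then have "u (x + y) - u y \<le> u x"
            unfolding u_def[of x] using False by (intro cINF_greatest) (auto simp: algebra_simps)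
          then show ?thesis by simp
        qed
        show "u (r *\<^sub>R x) \<le> r * u x" if "r > 0" for r x
        proof -
          have "u (r *\<^sub>R x) / r \<le> q x" if "q \<in> Ch" for q
            using le[OF that, of "r *\<^sub>R x"] sublinear_scale[OF sub(1)[OF that], of r x] \<open>r > 0\<close>
            by (simp add: field_simps)
          then have "u (r *\<^sub>R x) / r \<le> u x"
            unfolding u_def[of x] using False by (intro cINF_greatest) auto
          then show ?thesis using \<open>r > 0\<close> by (simp add: field_simps)
        qed
      qed
      moreover have "u \<le> p"
        using False le sub(2) by (metis (no_types, lifting) equals0I le_fun_def order_trans)
      ultimately show ?thesis using le by (auto simp: A_def le_fun_def)
    qed
  qed
  then obtain m where m: "sublinear m" "m \<le> p" and
    min: "\<And>a. sublinear a \<Longrightarrow> a \<le> m \<Longrightarrow> a = m"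
    unfolding A_def by (auto intro: order_trans)
  have add: "m (x + y) = m x + m y" for x y
  proof -
    obtain q' where "sublinear q'" "q' \<le> m" "\<And>x. q' x \<le> m (x + y) - m y"
      using sublinear_descent[OF m(1)] by blast
    then have "m x \<le> m (x + y) - m y" using min by blast
    then show ?thesis using sublinear_add[OF m(1), of x y] by simp
  qed
  have neg: "m (- x) = - m x" for x
    using add[of x "- x"] m(1) by (simp add: sublinear_def)
  have "m (r *\<^sub>R x) = r * m x" for r x
    using sublinear_scale[OF m(1), of r x] sublinear_scale[OF m(1), of "- r" x] neg[of "r *\<^sub>R x"]
    by (cases "r \<ge> 0") auto
  then have "linear m" using add by (intro linearI) auto
  with m(2) show ?thesis using that by blast
qed

text \<open>One descent in direction \<open>z\<close> gives \<open>q (- z) \<le> - p z\<close>; any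
  linear functional below \<open>q\<close> is then at least \<open>p z\<close> at
  \<open>z\<close>.\<close>

lemma exists_linear_below_sublinear_at:
  fixes p :: "'a::real_vector \<Rightarrow> real"
  assumes p: "sublinear p"
  obtains g where "linear g" "g \<le> p" "g z = p z"
proof -
  obtain q where q: "sublinear q" "q \<le> p" "\<And>x. q x \<le> p (x + z) - p z"
    using sublinear_descent[OF p] by blast
  obtain g where g: "linear g" "g \<le> q"
    using exists_linear_below_sublinear[OF q(1)] by blast
  have "g (- z) \<le> - p z"
    using g(2) q(3)[of "- z"] p by (smt (verit) add.left_inverse le_fun_def sublinear_def)
  then have "g z \<ge> p z" using linear_neg[OF g(1)] by simp
  moreover have "g \<le> p" using g q by (meson order_trans)
  ultimately show ?thesis using that[OF g(1)] by (simp add: le_fun_def antisym)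
qed

section \<open>Functionals measuring the distance to a subspace\<close>

lemma infdist_less_obtain:
  assumes "A \<noteq> {}" "infdist x A < e"
  obtains a where "a \<in> A" "dist x a < e"
  using assms cInf_lessD[of "dist x ` A" e] by (auto simp: infdist_notempty)

lemma sublinear_infdist:
  fixes K :: "'a::real_normed_vector set"
  assumes K: "subspace K"
  shows "sublinear (\<lambda>z. infdist z K)"
  unfolding sublinear_def
proof (intro conjI allI impI)
  have ne: "K \<noteq> {}" using subspace_0[OF K] by blast
  show "infdist 0 K = 0" using subspace_0[OF K] by simp
  show "infdist (x + y) K \<le> infdist x K + infdist y K" for x y
  proof (rule field_le_epsilon)
    fix e :: real assume "e > 0"
    obtain a where a: "a \<in> K" "dist x a < infdist x K + e/2"
      by (rule infdist_less_obtain[OF ne, of x "infdist x K + e/2"]) (use \<open>e > 0\<close> in auto)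
    obtain b where b: "b \<in> K" "dist y b < infdist y K + e/2"
      by (rule infdist_less_obtain[OF ne, of y "infdist y K + e/2"]) (use \<open>e > 0\<close> in auto)
    have "infdist (x + y) K \<le> dist (x + y) (a + b)"
      using a b subspace_add[OF K] by (intro infdist_le) auto
    also have "\<dots> \<le> dist x a + dist y b" by (rule dist_triangle_add)
    finally show "infdist (x + y) K \<le> infdist x K + infdist y K + e" using a b by simp
  qed
  show "infdist (r *\<^sub>R x) K \<le> r * infdist x K" if "r > 0" for r x
  proof (rule field_le_epsilon)
    fix e :: real assume "e > 0"
    obtain a where a: "a \<in> K" "dist x a < infdist x K + e/r"
      by (rule infdist_less_obtain[OF ne, of x "infdist x K + e/r"]) (use \<open>e > 0\<close> \<open>r > 0\<close> in auto)
    have "infdist (r *\<^sub>R x) K \<le> dist (r *\<^sub>R x) (r *\<^sub>R a)"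
      using a subspace_scale[OF K] by (intro infdist_le) auto
    also have "\<dots> = r * dist x a"
      using that by (simp add: dist_norm flip: scaleR_right_diff_distrib)
    also have "\<dots> \<le> r * (infdist x K + e/r)" using a that by (intro mult_left_mono) auto
    also have "\<dots> = r * infdist x K + e" using that by (simp add: field_simps)
    finally show "infdist (r *\<^sub>R x) K \<le> r * infdist x K + e" .
  qed
qed

text \<open>The distance to \<open>K\<close> as a sublinear majorant encodes all requirements: it is
  at most the norm, it vanishes on the symmetric set \<open>K\<close>, and a linear functional below
  it can touch it at \<open>z\<close>.\<close>

theorem Hahn_Banach_infdist:
  fixes K :: "'a::real_normed_vector set"
  assumes K: "subspace K"
  obtains g :: "'a \<Rightarrow>\<^sub>L real"
  where "norm g \<le> 1" "\<And>k. k \<in> K \<Longrightarrow> blinfun_apply g k = 0" "blinfun_apply g z = infdist z K"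
proof -
  obtain g where g: "linear g" "g \<le> (\<lambda>z. infdist z K)" "g z = infdist z K"
    using exists_linear_below_sublinear_at[OF sublinear_infdist[OF K]] by blast
  have up: "g x \<le> infdist x K" for x using g(2) by (simp add: le_fun_def)
  have "infdist x K \<le> norm x" for x
    using infdist_le[OF subspace_0[OF K], of x] by simp
  then have ub: "\<bar>g x\<bar> \<le> norm x" for x
    using up[of x] up[of "- x"] linear_neg[OF g(1), of x] by (smt (verit) norm_minus_cancel)
  have bl: "bounded_linear g"
    using g(1) ub by (intro bounded_linear_intro[where K=1]) (auto simp: linear_add linear_scale)
  then have ap: "blinfun_apply (Blinfun g) = g" by (rule bounded_linear_Blinfun_apply)
  show ?thesis
  proof
    show "norm (Blinfun g) \<le> 1"
      by (rule norm_blinfun_bound) (use ub ap in auto)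
    show "blinfun_apply (Blinfun g) k = 0" if "k \<in> K" for k
      using up[of k] up[of "- k"] that subspace_neg[OF K that] linear_neg[OF g(1), of k] ap by simp
    show "blinfun_apply (Blinfun g) z = infdist z K" using g ap by simp
  qed
qed

corollary norming_functional:
  fixes z :: "'a::real_normed_vector"
  obtains g :: "'a \<Rightarrow>\<^sub>L real" where "norm g \<le> 1" "blinfun_apply g z = norm z"
  using Hahn_Banach_infdist[OF subspace_single_0, of z] by auto

section \<open>Helly's theorem on systems of linear equations\<close>

lemma vanishing_on_kernels_imp_combination:
  fixes f :: "'i \<Rightarrow> 'a::real_normed_vector \<Rightarrow>\<^sub>L real"
  assumes "finite I" "\<And>z. (\<forall>i\<in>I. blinfun_apply (f i) z = 0) \<Longrightarrow> blinfun_apply g z = 0"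
  shows "\<exists>a. g = (\<Sum>i\<in>I. a i *\<^sub>R f i)"
  using assms
proof (induction I arbitrary: g rule: finite_induct)
  case empty
  then have "g = 0" by (intro blinfun_eqI) auto
  then show ?case by simp
next
  case (insert j I)
  show ?case
  proof (cases "\<forall>z. (\<forall>i\<in>I. blinfun_apply (f i) z = 0) \<longrightarrow> blinfun_apply (f j) z = 0")
    case True
    then obtain a where "g = (\<Sum>i\<in>I. a i *\<^sub>R f i)"
      using insert.IH[of g] insert.prems by blast
    then have "g = (\<Sum>i\<in>insert j I. (a(j := 0)) i *\<^sub>R f i)"
      using insert.hyps by (auto intro: sum.cong)
    then show ?thesis by blast
  next
    case False
    then obtain k where k: "\<And>i. i \<in> I \<Longrightarrow> blinfun_apply (f i) k = 0" "blinfun_apply (f j) k \<noteq> 0"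
      by blast
    define b where "b = blinfun_apply g k / blinfun_apply (f j) k"
    have "blinfun_apply (g - b *\<^sub>R f j) z = 0" if "\<forall>i\<in>I. blinfun_apply (f i) z = 0" for z
    proof -
      \<comment> \<open>Correcting \<open>z\<close> along \<open>k\<close> makes \<open>f j\<close>
        vanish and leaves the values of the other functionals alone.\<close>
      define w where "w = z - (blinfun_apply (f j) z / blinfun_apply (f j) k) *\<^sub>R k"
      have "\<forall>i\<in>insert j I. blinfun_apply (f i) w = 0"
        using that k by (auto simp: w_def blinfun.diff_right blinfun.scaleR_right)
      then have "blinfun_apply g w = 0" using insert.prems by blast
      then show ?thesis
        by (simp add: w_def b_def blinfun.diff_right blinfun.scaleR_right
            blinfun.diff_left blinfun.scaleR_left mult.commute)
    qed
    then obtain a where a: "g - b *\<^sub>R f j = (\<Sum>i\<in>I. a i *\<^sub>R f i)"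
      using insert.IH[of "g - b *\<^sub>R f j"] by blast
    have "(\<Sum>i\<in>I. (a(j := b)) i *\<^sub>R f i) = (\<Sum>i\<in>I. a i *\<^sub>R f i)"
      using insert.hyps by (intro sum.cong) auto
    then have "g = (\<Sum>i\<in>insert j I. (a(j := b)) i *\<^sub>R f i)"
      using insert.hyps a by (simp add: algebra_simps)
    then show ?thesis by blast
  qed
qed

text \<open>Equations are added one at a time. If \<open>f j\<close> depends on the others, the
  hypothesis makes its equation automatic; if not, the solution is adjusted along a vector of their
  common kernel.\<close>

lemma consistent_functional_system_solvable:
  fixes f :: "'i \<Rightarrow> 'a::real_normed_vector \<Rightarrow>\<^sub>L real"
  assumes "finite I" "\<And>a. (\<Sum>i\<in>I. a i *\<^sub>R f i) = 0 \<Longrightarrow> (\<Sum>i\<in>I. a i * c i) = 0"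
  shows "\<exists>z. \<forall>i\<in>I. blinfun_apply (f i) z = c i"
  using assms
proof (induction I rule: finite_induct)
  case (insert j I)
  have ext: "(\<Sum>i\<in>I. (a(j := b)) i *\<^sub>R f i) = (\<Sum>i\<in>I. a i *\<^sub>R f i)"
    "(\<Sum>i\<in>I. (a(j := b)) i * c i) = (\<Sum>i\<in>I. a i * c i)" for a b
    using insert.hyps by (auto intro!: sum.cong)
  have "(\<Sum>i\<in>I. a i * c i) = 0" if "(\<Sum>i\<in>I. a i *\<^sub>R f i) = 0" for a
    using insert.prems[of "a(j := 0)"] ext[of a 0] that insert.hyps by simp
  then obtain z where z: "\<And>i. i \<in> I \<Longrightarrow> blinfun_apply (f i) z = c i"
    using insert.IH by blast
  show ?case
  proof (cases "\<forall>z. (\<forall>i\<in>I. blinfun_apply (f i) z = 0) \<longrightarrow> blinfun_apply (f j) z = 0")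
    case True
    then obtain a where a: "f j = (\<Sum>i\<in>I. a i *\<^sub>R f i)"
      using vanishing_on_kernels_imp_combination[OF insert.hyps(1), of f "f j"] by blast
    \<comment> \<open>The coefficient \<open>-1\<close> at \<open>j\<close> turns the dependence
      into a vanishing combination, to which the hypothesis applies.\<close>
    then have "(\<Sum>i\<in>I. a i * c i) = c j"
      using insert.prems[of "a(j := -1)"] ext[of a "-1"] insert.hyps by simp
    moreover have "blinfun_apply (f j) z = (\<Sum>i\<in>I. a i * c i)"
      using z by (subst a) (simp add: blinfun.sum_left blinfun.scaleR_left)
    ultimately show ?thesis using z by auto
  next
    case False
    then obtain k where k: "\<And>i. i \<in> I \<Longrightarrow> blinfun_apply (f i) k = 0" "blinfun_apply (f j) k \<noteq> 0"
      by blast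
    then show ?thesis using z
      by (intro exI[of _ "z + ((c j - blinfun_apply (f j) z) / blinfun_apply (f j) k) *\<^sub>R k"])
        (auto simp: blinfun.add_right blinfun.scaleR_right)
  qed
qed auto

text \<open>The solutions form a coset \<open>z + K\<close> of the common kernel, so a short one
  exists if \<open>z\<close> is close to \<open>K\<close>. The functional attaining this distance is
  a combination of the \<open>f i\<close>, hence the distance is at most \<open>M\<close>; the gap
  up to \<open>M'\<close> is there because the distance need not be attained.\<close>

theorem Helly_functional_system:
  fixes f :: "'i \<Rightarrow> 'a::real_normed_vector \<Rightarrow>\<^sub>L real"
  assumes "finite I" "0 \<le> M" "M < M'"
    and M: "\<And>a. \<bar>\<Sum>i\<in>I. a i * c i\<bar> \<le> M * norm (\<Sum>i\<in>I. a i *\<^sub>R f i)"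
  obtains z where "norm z \<le> M'" "\<And>i. i \<in> I \<Longrightarrow> blinfun_apply (f i) z = c i"
proof -
  have "(\<Sum>i\<in>I. a i * c i) = 0" if "(\<Sum>i\<in>I. a i *\<^sub>R f i) = 0" for a
    using M[of a] that by simp
  then obtain z where z: "\<And>i. i \<in> I \<Longrightarrow> blinfun_apply (f i) z = c i"
    using consistent_functional_system_solvable[OF assms(1)] by blast
  define K where "K = {w. \<forall>i\<in>I. blinfun_apply (f i) w = 0}"
  have K: "subspace K"
    by (auto simp: K_def subspace_def blinfun.add_right blinfun.scaleR_right)
  obtain g :: "'a \<Rightarrow>\<^sub>L real" where g: "norm g \<le> 1" "\<And>k. k \<in> K \<Longrightarrow> blinfun_apply g k = 0"
    "blinfun_apply g z = infdist z K"
    using Hahn_Banach_infdist[OF K] by blast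
  obtain a where a: "g = (\<Sum>i\<in>I. a i *\<^sub>R f i)"
    using vanishing_on_kernels_imp_combination[OF assms(1), of f g] g(2) by (auto simp: K_def)
  have "infdist z K = (\<Sum>i\<in>I. a i * c i)"
    using z by (simp add: a blinfun.sum_left blinfun.scaleR_left flip: g(3))
  also have "\<dots> \<le> M * norm g" using M[of a] a by simp
  also have "\<dots> \<le> M" using g(1) assms(2) mult_left_le by blast
  finally have "infdist z K < M'" using assms(3) by simp
  then obtain k where k: "k \<in> K" "dist z k < M'"
    by (rule infdist_less_obtain[rotated]) (use subspace_0[OF K] in auto)
  show ?thesis
    by (rule that[of "z - k"]) (use k z in \<open>auto simp: K_def dist_norm blinfun.diff_right\<close>)
qed

section \<open>Order systems in non-reflexive spaces\<close>

text \<open>On a combination of the \<open>x i\<close>, \<open>\<phi> k\<close> returns the sum of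
  the coefficients with index at least \<open>k\<close>; in particular \<open>\<phi> 0\<close>
  returns the sum of all coefficients.\<close>

definition order_system :: "real \<Rightarrow> nat \<Rightarrow> (nat \<Rightarrow> 'a::real_normed_vector) \<Rightarrow> (nat \<Rightarrow> 'a \<Rightarrow>\<^sub>L real) \<Rightarrow> bool"
  where "order_system C N x \<phi> \<longleftrightarrow>
    (\<forall>i<N. norm (x i) \<le> C \<and> norm (\<phi> i) \<le> C) \<and>
    (\<forall>i<N. \<forall>k<N. blinfun_apply (\<phi> k) (x i) = (if k \<le> i then 1 else 0))"

lemma linear_canonical_bidual: "linear canonical_bidual"
  by (intro linearI blinfun_eqI)
    (simp_all add: blinfun.add_left blinfun.add_right blinfun.scaleR_left blinfun.scaleR_right)

lemma norm_canonical_bidual: "norm (canonical_bidual y) = norm y"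
proof (rule antisym)
  show "norm (canonical_bidual y) \<le> norm y"
  proof (rule norm_blinfun_bound)
    show "norm (blinfun_apply (canonical_bidual y) g) \<le> norm y * norm g" for g :: "'a \<Rightarrow>\<^sub>L real"
      using norm_blinfun[of g y] by (simp add: mult.commute)
  qed simp
  obtain g where g: "norm g \<le> 1" "blinfun_apply g y = norm y" by (rule norming_functional)
  have "norm y = blinfun_apply (canonical_bidual y) g" using g by simp
  also have "\<dots> \<le> norm (canonical_bidual y) * norm g"
    using norm_blinfun[of "canonical_bidual y" g] by simp
  also have "\<dots> \<le> norm (canonical_bidual y)" using g by (intro mult_left_le) auto
  finally show "norm y \<le> norm (canonical_bidual y)" .
qed

text \<open>The image of a complete space under an isometry is complete. Closedness gives a bidual
  element outside the range a positive distance to it.\<close>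

lemma closed_range_canonical_bidual:
  "closed (range (canonical_bidual :: 'y::banach \<Rightarrow> _))"
proof (rule complete_imp_closed, rule complete_isometric_image)
  show "bounded_linear (canonical_bidual :: 'y \<Rightarrow> _)"
    by (intro bounded_linear_intro[where K=1])
      (auto simp: linear_add[OF linear_canonical_bidual] linear_scale[OF linear_canonical_bidual]
        norm_canonical_bidual)
  show "\<forall>x\<in>UNIV. 1 * norm x \<le> norm (canonical_bidual (x :: 'y))"
    by (simp add: norm_canonical_bidual)
qed (auto simp: complete_UNIV)

text \<open>James's construction: fix \<open>F\<close> in the bidual at distance
  \<open>d > 0\<close> from the space. Helly's theorem supplies alternately a functional that kills
  the earlier vectors but on which \<open>F\<close> is 1, and a vector imitating \<open>F\<close> on
  all functionals found so far.\<close>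

theorem nonreflexive_order_systems:
  assumes "\<not> reflexive_space TYPE('y::banach)"
  obtains C where "C > 0" "\<And>N. \<exists>(y :: nat \<Rightarrow> 'y) \<phi>. order_system C N y \<phi>"
proof -
  let ?J = "canonical_bidual :: 'y \<Rightarrow> _"
  obtain F where F: "F \<notin> range ?J" using assms by (auto simp: reflexive_space_def)
  define d where "d = infdist F (range ?J)"
  have "d > 0" unfolding d_def
    using closed_range_canonical_bidual F by (intro infdist_pos_not_in_closed) auto
  have sub: "subspace (range ?J)"
    using linear_subspace_image[OF linear_canonical_bidual subspace_UNIV] .
  have F_dist: "\<bar>r\<bar> * d \<le> norm (w + r *\<^sub>R F)" if w: "w \<in> range ?J" for w r
  proof (cases "r = 0")
    case False
    have "- (inverse r *\<^sub>R w) \<in> range ?J"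
      using subspace_neg[OF sub subspace_scale[OF sub w]] .
    then have "d \<le> norm (F + inverse r *\<^sub>R w)"
      unfolding d_def using infdist_le[of "- (inverse r *\<^sub>R w)" "range ?J" F]
      by (simp add: dist_norm)
    then have "\<bar>r\<bar> * d \<le> \<bar>r\<bar> * norm (F + inverse r *\<^sub>R w)" by (intro mult_left_mono) auto
    also have "\<dots> = norm (r *\<^sub>R (F + inverse r *\<^sub>R w))" by simp
    also have "r *\<^sub>R (F + inverse r *\<^sub>R w) = w + r *\<^sub>R F" using False by (simp add: algebra_simps)
    finally show ?thesis .
  qed auto
  \<comment> \<open>The two uses of Helly's theorem have the constants \<open>1 / d\<close> and
    \<open>norm F\<close>, independent of \<open>N\<close>; adding 1 makes the inequalities
    strict.\<close>
  define C where "C = max (1 / d + 1) (norm F + 1)"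
  have "C > 0" by (simp add: C_def add_nonneg_pos less_max_iff_disj)
  \<comment> \<open>The clause on \<open>F\<close> is carried along because it makes the equations
    for the next vector consistent.\<close>
  have "\<exists>(y :: nat \<Rightarrow> 'y) \<phi>. order_system C N y \<phi> \<and> (\<forall>i<N. blinfun_apply F (\<phi> i) = 1)" for N
  proof (induction N)
    case 0
    show ?case by (auto simp: order_system_def)
  next
    case (Suc N)
    then obtain y :: "nat \<Rightarrow> 'y" and \<phi> where sys: "order_system C N y \<phi>"
      and F\<phi>: "\<And>i. i < N \<Longrightarrow> blinfun_apply F (\<phi> i) = 1" by blast
    \<comment> \<open>The equations with index below \<open>N\<close> concern the earlier vectors;
      index \<open>N\<close> stands for \<open>F\<close>.\<close>
    obtain \<psi> where \<psi>: "norm \<psi> \<le> C"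
      "\<And>i. i \<in> {..N} \<Longrightarrow> blinfun_apply (if i < N then ?J (y i) else F) \<psi> = (if i < N then 0 else 1)"
    proof (rule Helly_functional_system)
      fix a :: "nat \<Rightarrow> real"
      have c: "(\<Sum>i\<le>N. a i * (if i < N then 0 else 1)) = a N"
        by (simp flip: lessThan_Suc_atMost)
      define w where "w = (\<Sum>i<N. a i *\<^sub>R ?J (y i))"
      have "w \<in> range ?J"
        unfolding w_def by (intro subspace_sum[OF sub] subspace_scale[OF sub]) auto
      moreover have "(\<Sum>i\<le>N. a i *\<^sub>R (if i < N then ?J (y i) else F)) = w + a N *\<^sub>R F"
        by (simp add: w_def flip: lessThan_Suc_atMost)
      ultimately show "\<bar>\<Sum>i\<le>N. a i * (if i < N then 0 else 1)\<bar>
          \<le> 1 / d * norm (\<Sum>i\<le>N. a i *\<^sub>R (if i < N then ?J (y i) else F))"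
        using F_dist[of w "a N"] \<open>d > 0\<close> unfolding c by (simp add: field_simps)
    qed (use \<open>d > 0\<close> in \<open>auto simp: C_def less_max_iff_disj\<close>)
    have \<psi>y: "blinfun_apply \<psi> (y i) = 0" if "i < N" for i using \<psi>(2)[of i] that by simp
    have F\<psi>: "blinfun_apply F \<psi> = 1" using \<psi>(2)[of N] by simp
    define \<phi>' where "\<phi>' = \<phi>(N := \<psi>)"
    have F\<phi>': "blinfun_apply F (\<phi>' i) = 1" if "i \<le> N" for i
      using that F\<phi> F\<psi> by (auto simp: \<phi>'_def)
    obtain u where u: "norm u \<le> C" "\<And>i. i \<in> {..N} \<Longrightarrow> blinfun_apply (\<phi>' i) u = 1"
    proof (rule Helly_functional_system)
      fix a :: "nat \<Rightarrow> real"
      have "(\<Sum>i\<le>N. a i * 1) = blinfun_apply F (\<Sum>i\<le>N. a i *\<^sub>R \<phi>' i)"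
        using F\<phi>' by (simp add: blinfun.sum_right blinfun.scaleR_right)
      then show "\<bar>\<Sum>i\<le>N. a i * 1\<bar> \<le> norm F * norm (\<Sum>i\<le>N. a i *\<^sub>R \<phi>' i)"
        using norm_blinfun[of F "\<Sum>i\<le>N. a i *\<^sub>R \<phi>' i"] by simp
    qed (auto simp: C_def less_max_iff_disj)
    have "blinfun_apply \<psi> u = 1" using u(2)[of N] by (simp add: \<phi>'_def)
    moreover have "blinfun_apply (\<phi> i) u = 1" if "i < N" for i
      using u(2)[of i] that by (simp add: \<phi>'_def)
    ultimately have "order_system C (Suc N) (y(N := u)) \<phi>'"
      using sys \<psi>(1) u(1) \<psi>y by (auto simp: order_system_def \<phi>'_def less_Suc_eq)
    then show ?case using F\<phi>' by (metis less_Suc_eq_le)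
  qed
  then show ?thesis using that[OF \<open>C > 0\<close>] by blast
qed

section \<open>Order systems in a space that is not super-reflexive\<close>

text \<open>The vectors are moved by a map \<open>T\<close> with constant 2. Each functional is
  rebuilt by Hahn-Banach: the image of its kernel in the span has distance at least
  \<open>1 / (2 * C)\<close> from \<open>T (y k)\<close>, so a functional vanishing there and
  normalised at \<open>T (y k)\<close> has norm at most \<open>2 * C\<close>.\<close>

lemma finitely_representable_order_system:
  fixes y :: "nat \<Rightarrow> 'y::real_normed_vector"
  assumes fr: "finitely_representable TYPE('y) TYPE('x::real_normed_vector)"
    and sys: "order_system C N y \<phi>" and "C > 0"
  shows "\<exists>(x :: nat \<Rightarrow> 'x) \<psi>. order_system (2 * C) N x \<psi>"
proof -
  let ?B = "y ` {..<N}"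
  have "finite ?B" "(2::real) > 1" by auto
  then obtain T :: "'y \<Rightarrow> 'x" where T: "linear T"
    and T_bounds: "\<And>u. u \<in> span ?B \<Longrightarrow> inverse 2 * norm u \<le> norm (T u) \<and> norm (T u) \<le> 2 * norm u"
    using fr unfolding finitely_representable_def by meson
  have y: "norm (y i) \<le> C" "norm (\<phi> i) \<le> C" "y i \<in> span ?B" if "i < N" for i
    using that sys by (auto simp: order_system_def intro: span_base)
  have \<phi>y: "blinfun_apply (\<phi> k) (y i) = (if k \<le> i then 1 else 0)" if "i < N" "k < N" for i k
    using that sys by (simp add: order_system_def)
  have "\<exists>\<psi> :: 'x \<Rightarrow>\<^sub>L real. norm \<psi> \<le> 2 * C \<and>
      (\<forall>i<N. blinfun_apply \<psi> (T (y i)) = (if k \<le> i then 1 else 0))" if k: "k < N" for k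
  proof -
    let ?U = "span ?B \<inter> {u. blinfun_apply (\<phi> k) u = 0}"
    have "subspace ?U"
      by (auto simp: subspace_def blinfun.add_right blinfun.scaleR_right span_0 span_add span_scale)
    then have K: "subspace (T ` ?U)" by (rule linear_subspace_image[OF T])
    define d where "d = infdist (T (y k)) (T ` ?U)"
    have "1 / (2 * C) \<le> dist (T (y k)) (T u)" if u: "u \<in> ?U" for u
    proof -
      have "1 = \<bar>blinfun_apply (\<phi> k) (y k - u)\<bar>"
        using \<phi>y[OF k k] u by (simp add: blinfun.diff_right)
      also have "\<dots> \<le> norm (\<phi> k) * norm (y k - u)" using norm_blinfun[of "\<phi> k" "y k - u"] by simp
      also have "\<dots> \<le> C * (2 * norm (T (y k - u)))"
        using y[OF k] u T_bounds[of "y k - u"] \<open>C > 0\<close> by (intro mult_mono) (auto simp: span_diff)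
      finally show ?thesis using \<open>C > 0\<close> by (simp add: field_simps dist_norm linear_diff[OF T])
    qed
    moreover have "T ` ?U \<noteq> {}" using subspace_0[OF K] by blast
    ultimately have d: "1 / (2 * C) \<le> d"
      unfolding d_def by (subst infdist_notempty) (auto intro!: cINF_greatest)
    then have "d > 0" using \<open>C > 0\<close> by (smt (verit) zero_less_divide_1_iff)
    obtain g :: "'x \<Rightarrow>\<^sub>L real" where g: "norm g \<le> 1" "\<And>w. w \<in> T ` ?U \<Longrightarrow> blinfun_apply g w = 0"
      "blinfun_apply g (T (y k)) = d"
      using Hahn_Banach_infdist[OF K] unfolding d_def by blast
    let ?\<psi> = "inverse d *\<^sub>R g"
    have "blinfun_apply g (T (y i)) = (if k \<le> i then d else 0)" if "i < N" for i
    proof -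
      \<comment> \<open>\<open>y k\<close> is subtracted exactly when \<open>\<phi> k\<close> is 1
        at \<open>y i\<close>, which puts the difference into the kernel.\<close>
      let ?u = "y i - (if k \<le> i then 1 else 0) *\<^sub>R y k"
      have "?u \<in> ?U" using that k y \<phi>y by (auto simp: blinfun.diff_right span_diff)
      then have "blinfun_apply g (T ?u) = 0" using g(2) by blast
      then show ?thesis using g(3) by (auto simp: linear_diff[OF T] linear_0[OF T] blinfun.diff_right split: if_splits)
    qed
    then have "\<forall>i<N. blinfun_apply ?\<psi> (T (y i)) = (if k \<le> i then 1 else 0)"
      using \<open>d > 0\<close> by (simp add: blinfun.scaleR_left)
    moreover have "norm ?\<psi> \<le> 2 * C"
    proof -
      have "norm ?\<psi> \<le> inverse d" using g(1) \<open>d > 0\<close> by (simp add: field_simps)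
      also have "\<dots> \<le> 2 * C" using d \<open>C > 0\<close> \<open>d > 0\<close> by (simp add: field_simps)
      finally show ?thesis .
    qed
    ultimately show ?thesis by blast
  qed
  then obtain \<psi> :: "nat \<Rightarrow> 'x \<Rightarrow>\<^sub>L real" where \<psi>: "\<And>k. k < N \<Longrightarrow> norm (\<psi> k) \<le> 2 * C"
    "\<And>k i. k < N \<Longrightarrow> i < N \<Longrightarrow> blinfun_apply (\<psi> k) (T (y i)) = (if k \<le> i then 1 else 0)"
    by metis
  have "norm (T (y i)) \<le> 2 * C" if "i < N" for i
    using T_bounds[OF y(3)[OF that]] y(1)[OF that] by linarith
  then have "order_system (2 * C) N (\<lambda>i. T (y i)) \<psi>"
    using \<psi> by (simp add: order_system_def)
  then show ?thesis by blast
qed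

section \<open>Systems almost annihilated by finitely many functionals\<close>

lemma large_fibre:
  assumes "finite P" "h \<in> {..<card P * N + 1} \<rightarrow> P"
  obtains p where "N < card {i \<in> {..<card P * N + 1}. h i = p}"
proof (rule ccontr)
  let ?A = "\<lambda>p. {i \<in> {..<card P * N + 1}. h i = p}"
  assume "\<not> thesis"
  then have le: "card (?A p) \<le> N" for p using that by (meson not_le)
  have "{..<card P * N + 1} = (\<Union>p\<in>P. ?A p)" using assms(2) by auto
  then have "card P * N + 1 = card (\<Union>p\<in>P. ?A p)" by (metis card_lessThan)
  also have "\<dots> \<le> (\<Sum>p\<in>P. card (?A p))" by (rule card_UN_le[OF assms(1)])
  also have "\<dots> \<le> (\<Sum>p\<in>P. N)" by (intro sum_mono le)
  finally show False by simp
qed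

text \<open>
  By the pigeonhole principle many members of a long system have nearly equal values under all
  given functionals. Subtracting the first of them from the others makes these values small, and it
  does not disturb the functionals of the system, since these vanish at the subtracted vector.
\<close>

lemma order_system_almost_annihilated:
  fixes G :: "('x::real_normed_vector \<Rightarrow>\<^sub>L real) set"
  assumes sys: "\<And>N. \<exists>(x :: nat \<Rightarrow> 'x) \<phi>. order_system C N x \<phi>" and "C > 0"
    and "finite G" "\<delta> > 0"
  shows "\<exists>(x :: nat \<Rightarrow> 'x) \<phi>. order_system (2 * C) N x \<phi> \<and> (\<forall>g\<in>G. \<forall>i<N. \<bar>blinfun_apply g (x i)\<bar> \<le> \<delta>)"
proof -
  define R where "R g = norm g * C / \<delta>" for g :: "'x \<Rightarrow>\<^sub>L real"
  define P where "P = PiE G (\<lambda>g. {\<lfloor>- R g\<rfloor>..\<lfloor>R g\<rfloor>})"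
  have "finite P" unfolding P_def using \<open>finite G\<close> by (intro finite_PiE) auto
  define M where "M = card P * N + 1"
  obtain x :: "nat \<Rightarrow> 'x" and \<phi> where x: "order_system C M x \<phi>" using sys by blast
  \<comment> \<open>Values are rounded in units of \<open>\<delta>\<close>, so members with the same
    \<open>h\<close> have values at most \<open>\<delta>\<close> apart. Boundedness of the system
    leaves only finitely many patterns \<open>P\<close>.\<close>
  define h where "h i = restrict (\<lambda>g. \<lfloor>blinfun_apply g (x i) / \<delta>\<rfloor>) G" for i
  have "h i \<in> P" if "i < M" for i
  proof -
    have "\<bar>blinfun_apply g (x i)\<bar> \<le> norm g * C" for g :: "'x \<Rightarrow>\<^sub>L real"
      using norm_blinfun[of g "x i"] x that
      by (smt (verit) order_system_def mult_left_mono norm_ge_zero real_norm_def)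
    then have "- R g \<le> blinfun_apply g (x i) / \<delta>" "blinfun_apply g (x i) / \<delta> \<le> R g" for g
      unfolding R_def using \<open>\<delta> > 0\<close> by (auto simp: field_simps abs_le_iff) (smt (verit))
    then show ?thesis by (auto simp: P_def h_def intro!: floor_mono)
  qed
  \<comment> \<open>The fibre has at least \<open>N + 1\<close> members: one to subtract and
    \<open>N\<close> to keep.\<close>
  then obtain p where p: "N < card {i \<in> {..<M}. h i = p}"
    using large_fibre[OF \<open>finite P\<close>, of h N] unfolding M_def by auto
  define S where "S = {i \<in> {..<M}. h i = p}"
  define s where "s i = sorted_list_of_set S ! i" for i
  have "finite S" by (simp add: S_def)
  have len: "length (sorted_list_of_set S) = card S" by simp
  have s_in: "s i < M" "h (s i) = p" if "i \<le> N" for i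
  proof -
    have "s i \<in> set (sorted_list_of_set S)"
      unfolding s_def using that p len by (intro nth_mem) (auto simp: S_def)
    then show "s i < M" "h (s i) = p" using \<open>finite S\<close> by (auto simp: S_def)
  qed
  have s_less: "s i < s j" if "i < j" "j \<le> N" for i j
    unfolding s_def using that p len
    by (intro sorted_wrt_nth_less[OF strict_sorted_list_of_set]) (auto simp: S_def)
  have s_le: "s i \<le> s j \<longleftrightarrow> i \<le> j" if "i \<le> N" "j \<le> N" for i j
    using s_less[of i j] s_less[of j i] that by (metis leD le_less linorder_le_less_linear)
  define z where "z i = x (s (Suc i)) - x (s 0)" for i
  have \<phi>x: "blinfun_apply (\<phi> k) (x i) = (if k \<le> i then 1 else 0)" if "i < M" "k < M" for i k
    using that x by (simp add: order_system_def)
  have xC: "norm (x i) \<le> C" "norm (\<phi> i) \<le> C" if "i < M" for i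
    using that x by (simp_all add: order_system_def)
  have "norm (z i) \<le> 2 * C" if "i < N" for i
    unfolding z_def using xC(1)[OF s_in(1)[of "Suc i"]] xC(1)[OF s_in(1)[of 0]] that
      norm_triangle_ineq4[of "x (s (Suc i))" "x (s 0)"] by simp
  moreover have "norm (\<phi> (s (Suc i))) \<le> 2 * C" if "i < N" for i
    using xC(2)[OF s_in(1)[of "Suc i"]] that \<open>C > 0\<close> by simp
  moreover have "blinfun_apply (\<phi> (s (Suc k))) (z i) = (if k \<le> i then 1 else 0)"
    if "i < N" "k < N" for i k
    using that s_in(1) s_less[of 0 "Suc k"] by (simp add: z_def blinfun.diff_right \<phi>x s_le)
  ultimately have "order_system (2 * C) N z (\<lambda>k. \<phi> (s (Suc k)))"
    by (simp add: order_system_def)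
  moreover have "\<bar>blinfun_apply g (z i)\<bar> \<le> \<delta>" if "g \<in> G" "i < N" for g i
  proof -
    have "h (s (Suc i)) g = h (s 0) g" using s_in(2)[of "Suc i"] s_in(2)[of 0] that by simp
    then have "\<bar>blinfun_apply g (x (s (Suc i))) / \<delta> - blinfun_apply g (x (s 0)) / \<delta>\<bar> \<le> 1"
      using that(1) unfolding h_def by simp linarith
    then have "\<bar>blinfun_apply g (z i) / \<delta>\<bar> \<le> 1"
      by (simp add: z_def blinfun.diff_right diff_divide_distrib)
    then show ?thesis using \<open>\<delta> > 0\<close> by (simp add: abs_divide)
  qed
  ultimately show ?thesis by blast
qed

section \<open>Embedding the dyadic tree\<close>

text \<open>The index starts above 0, so the root contributes nothing and the blocks starting at
  level \<open>2 ^ 0\<close> cover every summand.\<close>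

definition path_sum :: "(int list \<Rightarrow> 'a::comm_monoid_add) \<Rightarrow> int list \<Rightarrow> 'a" where
  "path_sum v e = (\<Sum>j\<in>{0<..length e}. v (take j e))"

text \<open>The intersection with \<open>{..length e}\<close> is needed because \<open>take\<close>
  beyond the length would repeat the last vertex.\<close>

lemma path_sum_take_diff:
  fixes v :: "int list \<Rightarrow> 'a::ab_group_add"
  assumes "m \<le> n"
  shows "path_sum v (take n e) - path_sum v (take m e) = (\<Sum>j\<in>{m<..n} \<inter> {..length e}. v (take j e))"
proof -
  have *: "path_sum v (take n e) = (\<Sum>j\<in>{0<..n} \<inter> {..length e}. v (take j e))" for n
    unfolding path_sum_def by (intro sum.cong) (auto simp: min_def)
  have split: "{0<..n} \<inter> {..length e} = ({0<..m} \<inter> {..length e}) \<union> ({m<..n} \<inter> {..length e})"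
    using assms by auto
  then show ?thesis
    unfolding * split by (subst sum.union_disjoint) auto
qed

lemma path_sum_block:
  fixes v :: "int list \<Rightarrow> 'a::ab_group_add"
  shows "path_sum v (take (2 ^ Suc k - 1) e) - path_sum v (take (2 ^ k - 1) e)
    = (\<Sum>j\<in>{2 ^ k..<2 ^ Suc k} \<inter> {..length e}. v (take j e))"
proof -
  have "1 \<le> (2::nat) ^ k" by simp
  then have "{2 ^ k - 1<..2 ^ Suc k - 1} = {2 ^ k..<2 ^ Suc k :: nat}" by auto
  then show ?thesis using path_sum_take_diff[of "2 ^ k - 1" "2 ^ Suc k - 1" v e]
    by (simp add: diff_le_mono)
qed

text \<open>
  The binary number whose digits are the signs, padded with zeros to length \<open>n\<close>: in the tree
  of height \<open>n\<close> this is the position of the leftmost leaf below the given vertex.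
\<close>

primrec leaf_index :: "nat \<Rightarrow> int list \<Rightarrow> nat" where
  "leaf_index n [] = 0"
| "leaf_index n (a # s) = (if a = 1 then 2 ^ (n - 1) else 0) + leaf_index (n - 1) s"

lemma leaf_index_append: "leaf_index n (s @ t) = leaf_index n s + leaf_index (n - length s) t"
  by (induction s arbitrary: n) auto

lemma leaf_index_less: "length s \<le> n \<Longrightarrow> leaf_index n s < 2 ^ n"
proof (induction s arbitrary: n)
  case (Cons a s)
  then obtain m where "n = Suc m" by (cases n) auto
  then show ?case using Cons.IH[of m] Cons.prems by simp
qed auto

lemma dyadic_tree_append: "s @ t \<in> dyadic_tree \<longleftrightarrow> s \<in> dyadic_tree \<and> t \<in> dyadic_tree"
  by (auto simp: mem_dyadic_tree_iff)

lemma take_in_dyadic_tree: "e \<in> dyadic_tree \<Longrightarrow> take j e \<in> dyadic_tree"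
  using set_take_subset[of j e] by (auto simp: mem_dyadic_tree_iff)

text \<open>If the signs after the common prefix agreed, it could be prolonged.\<close>

lemma lcp_decomposition:
  assumes "e \<in> dyadic_tree" "e' \<in> dyadic_tree"
  obtains s t where "e = longest_common_prefix e e' @ s" "e' = longest_common_prefix e e' @ t"
    "s = [] \<or> t = [] \<or> hd s = 1 \<and> hd t = -1 \<or> hd s = -1 \<and> hd t = 1"
proof -
  let ?d = "longest_common_prefix e e'"
  obtain s t where st: "e = ?d @ s" "e' = ?d @ t"
    using longest_common_prefix_prefix1[of e e'] longest_common_prefix_prefix2[of e e']
    by (auto simp: prefix_def)
  have "hd s \<noteq> hd t" if "s \<noteq> []" "t \<noteq> []"
  proof
    assume "hd s = hd t"
    then have "prefix (?d @ [hd s]) e" "prefix (?d @ [hd s]) e'"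
      using st that by (metis append_Cons append_Nil append_assoc list.collapse prefix_def)+
    then have "prefix (?d @ [hd s]) ?d" by (rule longest_common_prefix_max_prefix)
    then show False using prefix_length_le by fastforce
  qed
  moreover have "s \<in> dyadic_tree" "t \<in> dyadic_tree"
    using assms st by (metis dyadic_tree_append)+
  then have "hd s \<in> {-1, 1}" if "s \<noteq> []" using that hd_in_set by (auto simp: mem_dyadic_tree_iff)
  moreover have "hd t \<in> {-1, 1}" if "t \<noteq> []"
    using that \<open>t \<in> dyadic_tree\<close> hd_in_set by (auto simp: mem_dyadic_tree_iff)
  ultimately show ?thesis by (intro that[OF st]) auto
qed

section \<open>Construction of the vectors block by block\<close>

text \<open>\<open>u\<close> holds the vectors below level \<open>2 ^ k\<close>, and
  \<open>v\<close> those of block \<open>k\<close>; they are separate only for the recursion and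
  coincide in the end. A path has at most \<open>2 ^ k\<close> vertices in the block, so the bound
  \<open>\<eta> / 2 ^ Suc k\<close> adds up to \<open>\<eta> / 2\<close> for each of two
  paths.\<close>

definition tree_block ::
  "real \<Rightarrow> real \<Rightarrow> nat \<Rightarrow> (int list \<Rightarrow> 'x::real_normed_vector) \<Rightarrow> (int list \<Rightarrow> 'x) \<Rightarrow> bool" where
  "tree_block C \<eta> k u v \<longleftrightarrow>
    (\<exists>x \<phi>. order_system C (2 ^ 2 ^ Suc k) x \<phi> \<and>
      (\<forall>s\<in>dyadic_tree. 2 ^ k \<le> length s \<longrightarrow> length s < 2 ^ Suc k \<longrightarrow> v s = x (leaf_index (2 ^ Suc k) s)) \<and>
      (\<forall>e\<in>dyadic_tree. \<forall>e'\<in>dyadic_tree. length e < 2 ^ k \<longrightarrow> length e' < 2 ^ k \<longrightarrow>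
        (\<exists>g :: 'x \<Rightarrow>\<^sub>L real. norm g \<le> 1 \<and>
          blinfun_apply g (path_sum u e - path_sum u e') = norm (path_sum u e - path_sum u e') \<and>
          (\<forall>i<2 ^ 2 ^ Suc k. \<bar>blinfun_apply g (x i)\<bar> \<le> \<eta> / 2 ^ Suc k))))"

lemma tree_block_cong:
  assumes "\<And>s. length s < 2 ^ k \<Longrightarrow> u s = u' s" "\<And>s. length s < 2 ^ Suc k \<Longrightarrow> v s = v' s"
  shows "tree_block C \<eta> k u v \<longleftrightarrow> tree_block C \<eta> k u' v'"
proof -
  have "path_sum u e = path_sum u' e" if "length e < 2 ^ k" for e
    unfolding path_sum_def using that assms(1) by (intro sum.cong) auto
  then show ?thesis using assms(2) by (simp add: tree_block_def cong: conj_cong imp_cong)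
qed

text \<open>Only finitely many differences of path sums occur below level \<open>2 ^ k\<close>, so
  finitely many norming functionals have to be almost annihilated; this doubles the
  constant.\<close>

lemma exists_tree_block:
  fixes u :: "int list \<Rightarrow> 'x::real_normed_vector"
  assumes sys: "\<And>N. \<exists>(x :: nat \<Rightarrow> 'x) \<phi>. order_system C N x \<phi>" and "C > 0" "\<eta> > 0"
  shows "\<exists>v. (\<forall>s. length s < 2 ^ k \<longrightarrow> v s = u s) \<and> tree_block (2 * C) \<eta> k u v"
proof -
  define A :: "int list set" where "A = {e \<in> dyadic_tree. length e < 2 ^ k}"
  have "finite A"
    by (rule finite_subset[OF _ finite_lists_length_le[of "{-1, 1}" "2 ^ k"]])
      (auto simp: A_def mem_dyadic_tree_iff)
  have "\<exists>g :: 'x \<Rightarrow>\<^sub>L real. norm g \<le> 1 \<and> blinfun_apply g z = norm z" for z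
    using norming_functional[of z] by metis
  then obtain g :: "'x \<Rightarrow> 'x \<Rightarrow>\<^sub>L real" where g: "\<And>z. norm (g z) \<le> 1" "\<And>z. blinfun_apply (g z) z = norm z"
    by metis
  define G where "G = (\<lambda>(e, e'). g (path_sum u e - path_sum u e')) ` (A \<times> A)"
  have "finite G" unfolding G_def using \<open>finite A\<close> by simp
  have "\<eta> / 2 ^ Suc k > 0" using \<open>\<eta> > 0\<close> by simp
  from order_system_almost_annihilated[OF sys \<open>C > 0\<close> \<open>finite G\<close> this, of "2 ^ 2 ^ Suc k"]
  obtain x :: "nat \<Rightarrow> 'x" and \<phi> where x: "order_system (2 * C) (2 ^ 2 ^ Suc k) x \<phi>"
    "\<And>h i. h \<in> G \<Longrightarrow> i < 2 ^ 2 ^ Suc k \<Longrightarrow> \<bar>blinfun_apply h (x i)\<bar> \<le> \<eta> / 2 ^ Suc k"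
    by (elim exE conjE) metis
  define v where "v s = (if length s < 2 ^ k then u s else x (leaf_index (2 ^ Suc k) s))" for s
  have "g (path_sum u e - path_sum u e') \<in> G" if "e \<in> A" "e' \<in> A" for e e'
    using that by (auto simp: G_def)
  then have "\<exists>h :: 'x \<Rightarrow>\<^sub>L real. norm h \<le> 1 \<and>
      blinfun_apply h (path_sum u e - path_sum u e') = norm (path_sum u e - path_sum u e') \<and>
      (\<forall>i<2 ^ 2 ^ Suc k. \<bar>blinfun_apply h (x i)\<bar> \<le> \<eta> / 2 ^ Suc k)" if "e \<in> A" "e' \<in> A" for e e'
    using that g x(2) by blast
  moreover have "v s = x (leaf_index (2 ^ Suc k) s)" if "2 ^ k \<le> length s" for s
    using that unfolding v_def by (meson not_le)
  ultimately have "tree_block (2 * C) \<eta> k u v"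
    unfolding tree_block_def A_def mem_Collect_eq using x(1) by blast
  moreover have "v s = u s" if "length s < 2 ^ k" for s using that by (simp add: v_def)
  ultimately show ?thesis by blast
qed

lemma exists_tree_of_blocks:
  assumes sys: "\<And>N. \<exists>(x :: nat \<Rightarrow> 'x::real_normed_vector) \<phi>. order_system C N x \<phi>" and "C > 0" "\<eta> > 0"
  shows "\<exists>v :: int list \<Rightarrow> 'x. \<forall>k. tree_block (2 * C) \<eta> k v v"
proof -
  \<comment> \<open>\<open>True\<close> is a trivial invariant, present to match the rule of
    dependent choice.\<close>
  have "\<exists>f :: nat \<Rightarrow> int list \<Rightarrow> 'x. \<forall>k. True \<and>
      ((\<forall>s. length s < 2 ^ k \<longrightarrow> f (Suc k) s = f k s) \<and> tree_block (2 * C) \<eta> k (f k) (f (Suc k)))"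
  proof (rule dependent_nat_choice)
    show "\<exists>v. True \<and> (\<forall>s. length s < 2 ^ k \<longrightarrow> v s = u s) \<and> tree_block (2 * C) \<eta> k u v"
      for u :: "int list \<Rightarrow> 'x" and k
      using exists_tree_block[OF assms, of k u] by simp
  qed simp
  then obtain f :: "nat \<Rightarrow> int list \<Rightarrow> 'x" where
    f: "\<And>k s. length s < 2 ^ k \<Longrightarrow> f (Suc k) s = f k s" "\<And>k. tree_block (2 * C) \<eta> k (f k) (f (Suc k))"
    by blast
  \<comment> \<open>Any stage \<open>k\<close> with \<open>length s < 2 ^ k\<close> gives the same
    value; \<open>length s\<close> is such a stage.\<close>
  define v where "v s = f (length s) s" for s
  have stable: "f (k + m) s = f k s" if "length s < 2 ^ k" for k m s
  proof (induction m)
    case (Suc m)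
    have "length s < 2 ^ (k + m)"
      using that by (rule order_less_le_trans) (simp add: power_increasing)
    then show ?case using f(1) Suc by simp
  qed simp
  have v: "v s = f k s" if "length s < 2 ^ k" for k s
  proof (cases "k \<le> length s")
    case True
    then show ?thesis using stable[OF that, of "length s - k"] by (simp add: v_def)
  next
    case False
    then show ?thesis using stable[OF less_exp, of s "k - length s"] by (simp add: v_def)
  qed
  have "tree_block (2 * C) \<eta> k v v" for k
    using f(2)[of k] tree_block_cong[of k v "f k" v "f (Suc k)"] v by blast
  then show ?thesis by blast
qed

section \<open>Estimates for one block\<close>

text \<open>The common part of the paths cancels. On the rest, \<open>\<phi> 0\<close> gives the
  difference of the numbers of vertices on the two branches, and one \<open>\<phi> c\<close> counts
  the right branch alone. At most two functionals are needed, hence the factor 2.\<close>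

lemma tree_block_separates:
  fixes v :: "int list \<Rightarrow> 'x::real_normed_vector"
  assumes blk: "tree_block C \<eta> k v v" and "C > 0"
    and e: "e \<in> dyadic_tree" "e' \<in> dyadic_tree"
  defines "I \<equiv> \<lambda>e. {2 ^ k..<2 ^ Suc k} \<inter> {..length e}"
    and "l \<equiv> length (longest_common_prefix e e')"
  shows "real (card (I e \<inter> {l<..})) \<le> 2 * C * norm ((\<Sum>j\<in>I e. v (take j e)) - (\<Sum>j\<in>I e'. v (take j e')))"
    (is "_ \<le> 2 * C * norm ?b")
proof (cases "I e \<inter> {l<..} = {}")
  case True
  then show ?thesis using \<open>C > 0\<close> by simp
next
  case False
  define L where "L = (2::nat) ^ Suc k"
  have "l < L" using False by (auto simp: I_def L_def)
  obtain x \<phi> where sys: "order_system C (2 ^ L) x \<phi>"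
    and vx: "\<And>s. s \<in> dyadic_tree \<Longrightarrow> 2 ^ k \<le> length s \<Longrightarrow> length s < L \<Longrightarrow> v s = x (leaf_index L s)"
    using blk unfolding tree_block_def L_def by blast
  obtain s t where st: "e = longest_common_prefix e e' @ s" "e' = longest_common_prefix e e' @ t"
    and hd: "s = [] \<or> t = [] \<or> hd s = 1 \<and> hd t = -1 \<or> hd s = -1 \<and> hd t = 1"
    using lcp_decomposition[OF e] by blast
  define d where "d = longest_common_prefix e e'"
  have st: "e = d @ s" "e' = d @ t" and ld: "length d = l" using st by (auto simp: d_def l_def)
  have "I e \<inter> {..l} = I e' \<inter> {..l}" by (auto simp: I_def st ld)
  then have "(\<Sum>j\<in>I e \<inter> {..l}. v (take j e)) = (\<Sum>j\<in>I e' \<inter> {..l}. v (take j e'))"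
    by (intro sum.cong) (auto simp: st ld)
  moreover have "(\<Sum>j\<in>I f. v (take j f)) = (\<Sum>j\<in>I f \<inter> {..l}. v (take j f)) + (\<Sum>j\<in>I f \<inter> {l<..}. v (take j f))" for f
    by (subst sum.union_disjoint[symmetric]) (auto simp: I_def intro!: sum.cong)
  moreover have "(\<Sum>j\<in>I f \<inter> {l<..}. v (take j f)) = (\<Sum>j\<in>I f \<inter> {l<..}. x (leaf_index L (take j f)))"
    if "f \<in> dyadic_tree" for f
    using that by (intro sum.cong refl vx take_in_dyadic_tree) (auto simp: I_def L_def)
  ultimately have b: "?b = (\<Sum>j\<in>I e \<inter> {l<..}. x (leaf_index L (take j e)))
      - (\<Sum>j\<in>I e' \<inter> {l<..}. x (leaf_index L (take j e')))"
    using e by simp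
  have idx: "leaf_index L (take j f) < 2 ^ L" if "j \<in> I f" for j f
    using that by (intro leaf_index_less) (auto simp: I_def L_def)
  have \<phi>x: "blinfun_apply (\<phi> c) (x (leaf_index L (take j f))) = (if c \<le> leaf_index L (take j f) then 1 else 0)"
    if "c < 2 ^ L" "j \<in> I f" for c j f
    using sys idx[OF that(2)] that(1) by (simp add: order_system_def)
  have \<phi>b: "blinfun_apply (\<phi> c) ?b =
      (\<Sum>j\<in>I e \<inter> {l<..}. if c \<le> leaf_index L (take j e) then 1 else 0)
      - (\<Sum>j\<in>I e' \<inter> {l<..}. if c \<le> leaf_index L (take j e') then 1 else 0)" if "c < 2 ^ L" for c
    unfolding b using that by (simp add: blinfun.diff_right blinfun.sum_right \<phi>x)
  have bound: "\<bar>blinfun_apply (\<phi> c) ?b\<bar> \<le> C * norm ?b" if "c < 2 ^ L" for c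
    using norm_blinfun[of "\<phi> c" ?b] sys that
    by (smt (verit) order_system_def mult_right_mono norm_ge_zero real_norm_def)
  have \<phi>0: "blinfun_apply (\<phi> 0) ?b = real (card (I e \<inter> {l<..})) - real (card (I e' \<inter> {l<..}))"
    by (subst \<phi>b) auto
  \<comment> \<open>The number of the right child of the common ancestor: it exceeds all numbers in
    the left subtree and is minimal in the right one. The child itself may lie above the
    block.\<close>
  define c where "c = leaf_index L (d @ [1])"
  have c: "c < 2 ^ L" unfolding c_def using \<open>l < L\<close> ld by (intro leaf_index_less) auto
  have right: "c \<le> leaf_index L (take j (d @ r))" if r: "hd r = 1" and j: "j \<in> I (d @ r) \<inter> {l<..}" for j r
  proof -
    obtain i where i: "j = l + Suc i" using j by (auto simp: less_iff_Suc_add)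
    have "r \<noteq> []" using j by (auto simp: I_def ld)
    then show ?thesis
      using r by (cases r) (auto simp: i c_def ld leaf_index_append)
  qed
  have left: "leaf_index L (take j (d @ r)) < c" if r: "hd r = -1" and j: "j \<in> I (d @ r) \<inter> {l<..}" for j r
  proof -
    obtain i where i: "j = l + Suc i" using j by (auto simp: less_iff_Suc_add)
    have "r \<noteq> []" using j by (auto simp: I_def ld)
    then obtain r' where r': "r = -1 # r'" using r by (cases r) auto
    have "leaf_index (L - l - 1) (take i r') < 2 ^ (L - l - 1)"
      using j by (intro leaf_index_less) (auto simp: i I_def L_def)
    then show ?thesis by (auto simp: i r' c_def ld leaf_index_append)
  qed
  have count_right: "(\<Sum>j\<in>I (d @ r) \<inter> {l<..}. if c \<le> leaf_index L (take j (d @ r)) then 1 else 0)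
      = real (card (I (d @ r) \<inter> {l<..}))" if "hd r = 1" for r
    using right[OF that] by (simp del: take_append)
  have count_left: "(\<Sum>j\<in>I (d @ r) \<inter> {l<..}. if c \<le> leaf_index L (take j (d @ r)) then 1 else 0) = (0::real)"
    if "hd r = -1" for r
    using left[OF that] by (intro sum.neutral ballI) (simp del: take_append add: not_le)
  have "0 \<le> C * norm ?b" using \<open>C > 0\<close> by simp
  have "s \<noteq> []" using False by (auto simp: I_def st ld)
  then consider "t = []" | "hd s = 1" "hd t = -1" | "hd s = -1" "hd t = 1" using hd by metis
  then have "real (card (I e \<inter> {l<..})) \<le> C * norm ?b + C * norm ?b"
  proof cases
    case 1
    then have "I e' \<inter> {l<..} = {}" by (auto simp: I_def st ld)
    then show ?thesis using \<phi>0 bound[of 0] \<open>0 \<le> C * norm ?b\<close> by (simp add: abs_le_iff)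
  next
    case 2
    then have "blinfun_apply (\<phi> c) ?b = real (card (I e \<inter> {l<..}))"
      unfolding \<phi>b[OF c] by (simp add: st count_right count_left del: take_append)
    then show ?thesis using bound[OF c] \<open>0 \<le> C * norm ?b\<close> by linarith
  next
    \<comment> \<open>Now \<open>\<phi> c\<close> sees only the branch of \<open>e'\<close>; adding
      its count to the difference given by \<open>\<phi> 0\<close> recovers that of
      \<open>e\<close>.\<close>
    case 3
    then have "blinfun_apply (\<phi> c) ?b = - real (card (I e' \<inter> {l<..}))"
      unfolding \<phi>b[OF c] by (simp add: st count_right count_left del: take_append)
    then show ?thesis using \<phi>0 bound[OF c] bound[of 0] by (simp add: abs_le_iff)
  qed
  then show ?thesis by simp
qed

text \<open>The functional norming \<open>D k\<close> changes by at most \<open>\<eta>\<close> from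
  \<open>D k\<close> to \<open>D (Suc k)\<close>, since it is small on all vectors of block
  \<open>k\<close>.\<close>

lemma tree_block_almost_independent:
  fixes v :: "int list \<Rightarrow> 'x::real_normed_vector"
  assumes blk: "tree_block C \<eta> k v v" and "\<eta> > 0"
    and e: "e \<in> dyadic_tree" "e' \<in> dyadic_tree"
  defines "D \<equiv> \<lambda>k. path_sum v (take (2 ^ k - 1) e) - path_sum v (take (2 ^ k - 1) e')"
  shows "norm (D k) \<le> norm (D (Suc k)) + \<eta>"
proof -
  define I where "I f = {2 ^ k..<2 ^ Suc k} \<inter> {..length f}" for f :: "int list"
  obtain x \<phi> where sys: "order_system C (2 ^ 2 ^ Suc k) x \<phi>"
    and vx: "\<And>s. s \<in> dyadic_tree \<Longrightarrow> 2 ^ k \<le> length s \<Longrightarrow> length s < 2 ^ Suc k \<Longrightarrow>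
        v s = x (leaf_index (2 ^ Suc k) s)"
    and norming: "\<And>e e'. e \<in> dyadic_tree \<Longrightarrow> e' \<in> dyadic_tree \<Longrightarrow> length e < 2 ^ k \<Longrightarrow> length e' < 2 ^ k \<Longrightarrow>
        (\<exists>g :: 'x \<Rightarrow>\<^sub>L real. norm g \<le> 1 \<and>
          blinfun_apply g (path_sum v e - path_sum v e') = norm (path_sum v e - path_sum v e') \<and>
          (\<forall>i<2 ^ 2 ^ Suc k. \<bar>blinfun_apply g (x i)\<bar> \<le> \<eta> / 2 ^ Suc k))"
    using blk unfolding tree_block_def by blast
  have short: "length (take (2 ^ k - 1) f) < 2 ^ k" for f :: "int list"
    by (metis diff_less length_take less_imp_diff_less min.strict_coboundedI2 min.commute
        zero_less_numeral zero_less_one zero_less_power)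
  obtain g :: "'x \<Rightarrow>\<^sub>L real" where g: "norm g \<le> 1" "blinfun_apply g (D k) = norm (D k)"
    "\<And>i. i < 2 ^ 2 ^ Suc k \<Longrightarrow> \<bar>blinfun_apply g (x i)\<bar> \<le> \<eta> / 2 ^ Suc k"
    using norming[OF e[THEN take_in_dyadic_tree] short short] unfolding D_def by blast
  have small: "\<bar>blinfun_apply g (\<Sum>j\<in>I f. v (take j f))\<bar> \<le> \<eta> / 2" if "f \<in> dyadic_tree" for f
  proof -
    have "\<bar>blinfun_apply g (v (take j f))\<bar> \<le> \<eta> / 2 ^ Suc k" if j: "j \<in> I f" for j
    proof -
      have "v (take j f) = x (leaf_index (2 ^ Suc k) (take j f))"
        using j by (intro vx take_in_dyadic_tree \<open>f \<in> dyadic_tree\<close>) (auto simp: I_def)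
      moreover have "leaf_index (2 ^ Suc k) (take j f) < 2 ^ 2 ^ Suc k"
        using j by (intro leaf_index_less) (auto simp: I_def)
      ultimately show ?thesis using g(3) by metis
    qed
    then have "\<bar>blinfun_apply g (\<Sum>j\<in>I f. v (take j f))\<bar> \<le> (\<Sum>j\<in>I f. \<eta> / 2 ^ Suc k)"
      by (subst blinfun.sum_right, intro order_trans[OF sum_abs] sum_mono)
    also have "\<dots> \<le> (\<Sum>j\<in>{2 ^ k..<2 ^ Suc k :: nat}. \<eta> / 2 ^ Suc k)"
      using \<open>\<eta> > 0\<close> by (intro sum_mono2) (auto simp: I_def)
    also have "\<dots> = \<eta> / 2" by simp
    finally show ?thesis .
  qed
  have "D (Suc k) - D k = (\<Sum>j\<in>I e. v (take j e)) - (\<Sum>j\<in>I e'. v (take j e'))"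
    unfolding D_def I_def path_sum_block[symmetric] by simp
  then have "\<bar>blinfun_apply g (D (Suc k)) - blinfun_apply g (D k)\<bar> \<le> \<eta>"
    using small[OF e(1)] small[OF e(2)]
    unfolding blinfun.diff_right[symmetric] by (simp add: blinfun.diff_right)
  moreover have "\<bar>blinfun_apply g (D (Suc k))\<bar> \<le> norm (D (Suc k))"
    using norm_blinfun[of g "D (Suc k)"] g(1)
    by (smt (verit) mult_left_le_one_le norm_ge_zero real_norm_def)
  ultimately show ?thesis using g(2) by linarith
qed

text \<open>
  Here \<open>a\<close> is the length of the longer of two vertices and \<open>l\<close> that of their common ancestor. If
  \<open>l < 2\<^sup>m\<^sup>-\<^sup>1\<close>, then the levels \<open>2\<^sup>m\<^sup>-\<^sup>1, \<dots>, a\<close> make up at least half of all levels up to \<open>a\<close>.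
\<close>

lemma top_blocks_large:
  fixes l a m :: nat
  assumes "l < a" "2 ^ m \<le> a" "a < 2 ^ Suc m"
  defines "p \<equiv> \<lambda>k. card ({2 ^ k..<2 ^ Suc k} \<inter> {..a} \<inter> {l<..})"
  shows "a - l \<le> 2 * p m \<or> (\<exists>n. m = Suc n \<and> a - l \<le> 2 * (p m + p n))"
proof (cases "2 ^ m \<le> Suc l")
  case True
  then have "{2 ^ m..<2 ^ Suc m} \<inter> {..a} \<inter> {l<..} = {l<..a}" using assms by auto
  then show ?thesis by (simp add: p_def)
next
  case False
  then obtain n where n: "m = Suc n" by (cases m) auto
  have "{2 ^ m..<2 ^ Suc m} \<inter> {..a} \<inter> {l<..} = {2 ^ m..a}" using assms False by auto
  then have pm: "p m = Suc a - 2 ^ m" by (simp add: p_def)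
  have "{2 ^ n..<2 ^ Suc n} \<inter> {..a} \<inter> {l<..} = {max (Suc l) (2 ^ n)..<2 ^ m}"
    using assms(2) False by (auto simp: n)
  then have pn: "p n = 2 ^ m - max (Suc l) (2 ^ n)" by (simp add: p_def)
  have "(2::nat) ^ m = 2 * 2 ^ n" by (simp add: n)
  then have "a - l \<le> 2 * (p m + p n)"
    unfolding pm pn using assms(1,2) False by (cases "Suc l \<le> 2 ^ n") (simp_all add: max_def)
  then show ?thesis using n by blast
qed

section \<open>Lipschitz bounds and the embedding\<close>

text \<open>At least half of the levels of \<open>e\<close> below the common ancestor lie in its
  last two blocks. Separation bounds their number by the truncated differences \<open>D\<close>, and
  these are bounded by the full difference up to multiples of \<open>\<eta>\<close>.\<close>

lemma path_sum_lower_bound: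
  fixes v :: "int list \<Rightarrow> 'x::real_normed_vector"
  assumes blk: "\<And>k. tree_block C (1 / (64 * C)) k v v" and "C > 0"
    and e: "e \<in> dyadic_tree" "e' \<in> dyadic_tree" and "e \<noteq> e'" "length e' \<le> length e"
  shows "hyperbolic_dist e e' \<le> 64 * C * norm (path_sum v e - path_sum v e')"
proof -
  define \<eta> where "\<eta> = 1 / (64 * C)"
  have "\<eta> > 0" using \<open>C > 0\<close> by (simp add: \<eta>_def)
  define l where "l = length (longest_common_prefix e e')"
  define D where "D k = path_sum v (take (2 ^ k - 1) e) - path_sum v (take (2 ^ k - 1) e')" for k :: nat
  define p where "p k = card ({2 ^ k..<2 ^ Suc k} \<inter> {..length e} \<inter> {l<..})" for k :: nat
  have step: "norm (D k) \<le> norm (D (Suc k)) + \<eta>" for k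
    using tree_block_almost_independent[OF blk _ e, of k] \<open>\<eta> > 0\<close> by (simp add: D_def \<eta>_def)
  have p: "real (p k) \<le> 2 * C * (norm (D (Suc k)) + norm (D k))" for k
  proof -
    have "real (p k) \<le> 2 * C * norm (D (Suc k) - D k)"
      using tree_block_separates[OF blk \<open>C > 0\<close> e, of k]
      unfolding path_sum_block[symmetric] by (simp add: p_def l_def D_def algebra_simps)
    also have "\<dots> \<le> 2 * C * (norm (D (Suc k)) + norm (D k))"
      using \<open>C > 0\<close> by (intro mult_left_mono norm_triangle_ineq4) auto
    finally show ?thesis .
  qed
  have l: "l \<le> length e'" "l \<le> length e"
    unfolding l_def using longest_common_prefix_prefix1 longest_common_prefix_prefix2 prefix_length_le by blast+
  have \<rho>: "hyperbolic_dist e e' = real (length e - l) + real (length e' - l)"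
    using l by (simp add: hyperbolic_dist_def l_def of_nat_diff)
  have "l < length e"
  proof (rule ccontr)
    assume "\<not> l < length e"
    then have "hyperbolic_dist e e' = 0" using l \<open>length e' \<le> length e\<close> by (simp add: \<rho>)
    then show False using \<open>e \<noteq> e'\<close> e Metric_space.zero[OF Metric_space_dyadic_tree] by blast
  qed
  obtain m where m: "2 ^ m \<le> length e" "length e < 2 ^ Suc m"
    using ex_power_ivl1[of 2 "length e"] \<open>l < length e\<close> by auto
  \<comment> \<open>Both vertices have length at most \<open>2 ^ Suc m - 1\<close>, so this
    truncation changes nothing.\<close>
  have Dm: "D (Suc m) = path_sum v e - path_sum v e'"
    unfolding D_def using m(2) \<open>length e' \<le> length e\<close> by (subst (1 2) take_all) auto
  have pm: "real (p m) \<le> 2 * C * (2 * norm (D (Suc m)) + \<eta>)"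
    by (rule order_trans[OF p]) (use step[of m] \<open>C > 0\<close> in \<open>auto intro!: mult_left_mono\<close>)
  have "real (length e - l) \<le> 2 * (2 * C * (4 * norm (D (Suc m)) + 4 * \<eta>))"
    using top_blocks_large[OF \<open>l < length e\<close> m]
  proof (elim disjE exE conjE)
    assume "length e - l \<le> 2 * card ({2 ^ m..<2 ^ Suc m} \<inter> {..length e} \<inter> {l<..})"
    then have "real (length e - l) \<le> 2 * real (p m)" unfolding p_def by linarith
    also have "\<dots> \<le> 2 * (2 * C * (2 * norm (D (Suc m)) + \<eta>))" using pm by simp
    also have "\<dots> \<le> 2 * (2 * C * (4 * norm (D (Suc m)) + 4 * \<eta>))"
      using \<open>C > 0\<close> \<open>\<eta> > 0\<close> by (intro mult_left_mono add_mono) auto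
    finally show ?thesis .
  next
    fix n assume n: "m = Suc n"
      and top: "length e - l \<le> 2 * (card ({2 ^ m..<2 ^ Suc m} \<inter> {..length e} \<inter> {l<..})
        + card ({2 ^ n..<2 ^ Suc n} \<inter> {..length e} \<inter> {l<..}))"
    from top have "length e - l \<le> 2 * (p m + p n)" by (simp only: p_def)
    then have "real (length e - l) \<le> real (2 * (p m + p n))" by (simp only: of_nat_le_iff)
    also have "\<dots> = 2 * (real (p m) + real (p n))" by simp
    \<comment> \<open>One step leads from \<open>D m\<close> to \<open>D (Suc m)\<close> and two
      from \<open>D n\<close>, which costs \<open>\<eta>\<close> and
      \<open>2 * \<eta>\<close>.\<close>
    also have "real (p n) \<le> 2 * C * (2 * norm (D (Suc m)) + 3 * \<eta>)"
      by (rule order_trans[OF p]) (use step[of m] step[of n] \<open>C > 0\<close> n in \<open>auto intro!: mult_left_mono\<close>)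
    finally show ?thesis using pm by (simp add: algebra_simps)
  qed
  moreover have "2 * (2 * C * (4 * norm (D (Suc m)) + 4 * \<eta>)) = 16 * C * norm (D (Suc m)) + 1 / 4"
    using \<open>C > 0\<close> by (simp add: \<eta>_def field_simps)
  moreover have "1 \<le> real (length e - l)" using \<open>l < length e\<close> by simp
  \<comment> \<open>The choice of \<open>\<eta>\<close> leaves an error of \<open>1 / 4\<close>,
    absorbed because the left side is at least 1.\<close>
  ultimately have "real (length e - l) \<le> 32 * C * norm (D (Suc m))" by linarith
  then show ?thesis using \<rho> \<open>length e' \<le> length e\<close> Dm by simp
qed

text \<open>Every vertex except the root lies in a block, so its vector has norm at most
  \<open>C\<close>, and each edge on the way through the common ancestor costs at most
  \<open>C\<close>.\<close>

lemma path_sum_upper_bound: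
  fixes v :: "int list \<Rightarrow> 'x::real_normed_vector"
  assumes blk: "\<And>k. tree_block C \<eta> k v v" and e: "e \<in> dyadic_tree" "e' \<in> dyadic_tree"
  shows "norm (path_sum v e - path_sum v e') \<le> C * hyperbolic_dist e e'"
proof -
  have v: "norm (v s) \<le> C" if s: "s \<in> dyadic_tree" "s \<noteq> []" for s
  proof -
    obtain k where k: "2 ^ k \<le> length s" "length s < 2 ^ Suc k"
      using ex_power_ivl1[of 2 "length s"] s(2) by (auto simp: Suc_le_eq)
    obtain x \<phi> where "order_system C (2 ^ 2 ^ Suc k) x \<phi>" "v s = x (leaf_index (2 ^ Suc k) s)"
      using blk[of k] k s(1) unfolding tree_block_def by blast
    then show ?thesis using k leaf_index_less[of s "2 ^ Suc k"] by (simp add: order_system_def)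
  qed
  have below: "norm (path_sum v f - path_sum v d) \<le> C * real (length f - length d)"
    if f: "f \<in> dyadic_tree" "prefix d f" for f d
  proof -
    have d: "take (length d) f = d" "length d \<le> length f"
      using f(2) by (auto simp: prefix_def)
    have "path_sum v f - path_sum v d = (\<Sum>j\<in>{length d<..length f}. v (take j f))"
      using path_sum_take_diff[OF d(2), of v f] by (simp add: d Int_absorb2 greaterThanAtMost_def)
    also have "norm \<dots> \<le> (\<Sum>j\<in>{length d<..length f}. C)"
      by (intro sum_norm_le v take_in_dyadic_tree f) auto
    finally show ?thesis by (simp add: mult.commute)
  qed
  let ?d = "longest_common_prefix e e'"
  have pre: "prefix ?d e" "prefix ?d e'"
    by (rule longest_common_prefix_prefix1 longest_common_prefix_prefix2)+
  have "norm (path_sum v e - path_sum v e')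
      \<le> norm (path_sum v e - path_sum v ?d) + norm (path_sum v e' - path_sum v ?d)"
    using norm_triangle_ineq4[of "path_sum v e - path_sum v ?d" "path_sum v e' - path_sum v ?d"] by simp
  also have "\<dots> \<le> C * real (length e - length ?d) + C * real (length e' - length ?d)"
    using below e pre by (intro add_mono) auto
  also have "\<dots> = C * hyperbolic_dist e e'"
    using pre[THEN prefix_length_le] by (simp add: hyperbolic_dist_def of_nat_diff algebra_simps)
  finally show ?thesis .
qed

lemma metric_embeddingI:
  assumes M: "Metric_space M d" and "f \<in> M \<rightarrow> N" "B \<ge> 0"
    and upper: "\<And>x y. x \<in> M \<Longrightarrow> y \<in> M \<Longrightarrow> x \<noteq> y \<Longrightarrow> dist (f x) (f y) \<le> A * d x y"
    and lower: "\<And>x y. x \<in> M \<Longrightarrow> y \<in> M \<Longrightarrow> x \<noteq> y \<Longrightarrow> d x y \<le> B * dist (f x) (f y)"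
  shows "metric_embedding M d N dist f"
proof -
  have d: "d x y > 0" if "x \<in> M" "y \<in> M" "x \<noteq> y" for x y
    using M that by (metis Metric_space.mdist_pos_less)
  then have D: "dist (f x) (f y) > 0" if "x \<in> M" "y \<in> M" "x \<noteq> y" for x y
    using that lower[OF that] by (smt (verit) mult_not_zero zero_le_dist)
  have "inj_on f M" using D by (intro inj_onI) (metis dist_self less_irrefl)
  moreover have "(SUP (x, y) \<in> {(x, y). x \<in> M \<and> y \<in> M \<and> x \<noteq> y}. ennreal (dist (f x) (f y) / d x y)) \<le> ennreal A"
    using upper d by (intro SUP_least) (auto intro!: ennreal_leI simp: divide_le_eq)
  moreover have "(SUP (x, y) \<in> {(x, y). x \<in> M \<and> y \<in> M \<and> x \<noteq> y}. ennreal (d x y / dist (f x) (f y))) \<le> ennreal B"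
    using lower D by (intro SUP_least) (auto intro!: ennreal_leI simp: divide_le_eq)
  ultimately have "distortion M d dist f \<le> ennreal A * ennreal B"
    unfolding distortion_def by (intro mult_mono) auto
  also have "\<dots> < \<infinity>" by (simp add: ennreal_mult_less_top)
  finally show ?thesis using \<open>inj_on f M\<close> assms(2) by (simp add: metric_embedding_def)
qed

theorem theorem1p1:
  assumes "not_super_reflexive_witness TYPE('x::banach) TYPE('y::banach)"
  shows "\<exists>f :: int list \<Rightarrow> 'x.
    metric_embedding dyadic_tree hyperbolic_dist (UNIV :: 'x set) dist f"
proof -
  have fr: "finitely_representable TYPE('y) TYPE('x)" and nr: "\<not> reflexive_space TYPE('y)"
    using assms by (simp_all add: not_super_reflexive_witness_def)
  obtain C0 where C0: "C0 > 0" "\<And>N. \<exists>(y :: nat \<Rightarrow> 'y) \<phi>. order_system C0 N y \<phi>"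
    using nonreflexive_order_systems[OF nr] by blast
  have sys: "\<exists>(x :: nat \<Rightarrow> 'x) \<psi>. order_system (2 * C0) N x \<psi>" for N
    using C0(2)[of N] finitely_representable_order_system[OF fr _ C0(1)] by blast
  \<comment> \<open>The inner factor 2 comes from finite representability, the outer one from almost
    annihilation.\<close>
  define C where "C = 2 * (2 * C0)"
  have "C > 0" using C0 by (simp add: C_def)
  obtain v :: "int list \<Rightarrow> 'x" where v: "\<And>k. tree_block C (1 / (64 * C)) k v v"
    using exists_tree_of_blocks[OF sys, of "1 / (64 * C)"] C0(1) \<open>C > 0\<close> unfolding C_def by fastforce
  have "metric_embedding dyadic_tree hyperbolic_dist (UNIV :: 'x set) dist (path_sum v)"
  proof (rule metric_embeddingI[OF Metric_space_dyadic_tree])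
    fix e e' assume e: "e \<in> dyadic_tree" "e' \<in> dyadic_tree" "e \<noteq> e'"
    show "dist (path_sum v e) (path_sum v e') \<le> C * hyperbolic_dist e e'"
      using path_sum_upper_bound[OF v e(1,2)] by (simp add: dist_norm)
    show "hyperbolic_dist e e' \<le> 64 * C * dist (path_sum v e) (path_sum v e')"
    proof (cases "length e' \<le> length e")
      case True
      then show ?thesis using path_sum_lower_bound[OF v \<open>C > 0\<close> e(1,2,3)] by (simp add: dist_norm)
    next
      case False
      then have "hyperbolic_dist e' e \<le> 64 * C * norm (path_sum v e' - path_sum v e)"
        using path_sum_lower_bound[OF v \<open>C > 0\<close> e(2,1)] e(3) by simp
      then show ?thesis
        using Metric_space.commute[OF Metric_space_dyadic_tree, of e e'] by (simp add: dist_norm norm_minus_commute)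
    qed
  qed (use \<open>C > 0\<close> in auto)
  then show ?thesis by blast
qed

end
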